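(* Consider a well-formed cross-chain deal executed with the timelock protocol in the synchronous communication model with bound $\Delta$. Then the timelock protocol satisfies strong liveness: if all parties are compliant and willing to accept their proposed payoffs, then all transfers happen, i.e. every party's payoff is ALL.
   Context: **Parties, assets, contracts.** A deal $D$ involves a finite list $\mathit{plist}$ of $N$ parties. Each asset has exactly one owner at a time and lives on a blockchain. A blockchain is a publicly readable, tamper-proof ledger that can host contracts. Contracts are public, deterministic, passive, trusted programs, which see only data on their own blockchain or data submitted to them by parties. Every party can read the state of any contract. Signatures cannot be forged and messages cannot be replayed (deal identifiers are unique). A party is *compliant* if it follows the protocol below. Otherwise it is *deviating* and may behave arbitrarily. **Deal.** A deal specifies a set of transfers of assets between parties. It is viewed as a directed graph whose vertices are the parties and whose arcs are the transfers. A transfer from $P$ to $Q$ is an *outgoing* transfer (asset) of $P$ and an *incoming* transfer (asset) of $Q$. A party may relay an asset, so the same asset can be both incoming and outgoing for a party. The deal is *well-formed*, which here means that its digraph is strongly connected. **Payoffs.** A party's payoff in an execution is the pair consisting of the set of its incoming assets and the set of its outgoing assets actually (permanently) transferred. ALL is the payoff in which all agreed transfers take place. A party is willing to accept its proposed payoff if, in the validation step below, it deems the payoff acceptable and votes to commit. **Synchronous model.** $\Delta>0$ is a known bound on propagation time. If a vote is accepted by a contract at time $t$, a compliant party monitoring that contract can observe it and have it delivered, forwarded, to other contracts by time $t+\Delta$. **Timelock protocol.** 1. *Clearing.* All parties are sent $D$, $\mathit{plist}$, a commit-phase starting time $t_0$ and $\Delta$ by an untrusted service. The time $t_0$ is far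 enough in the future for the escrow, transfer and validation steps of compliant parties to finish before it. 2. *Escrow.* The owner of an asset $a$ (who must be in $\mathit{plist}$) may place it in escrow with an escrow contract on $a$'s blockchain, recording $D,\mathit{plist},t_0,\Delta$. The contract becomes the owner of $a$. The contract records an abort-owner $A(a)$ and a commit-owner $C(a)$, both initially the escrowing party. Each compliant party escrows its outgoing assets that it initially owns. 3. *Transfer.* The current commit-owner $P=C(a)$ of an escrowed asset $a$ (and only $P$) may tentatively transfer it to a party $Q\in\mathit{plist}$, which sets $C(a):=Q$. Compliant parties perform the tentative transfers specified by the deal. 4. *Validation.* Each compliant party checks that its incoming assets are properly escrowed with the correct deal information, and that the payoff in which all its tentatively transferred incoming and outgoing assets are transferred is acceptable to it. If so it votes to commit. Otherwise it does not vote. 5. *Commit.* A vote of party $v$ carries a *path signature* $p$, a sequence of signatures beginning with $v$'s and followed by those of the successive parties that forwarded it. $|p|$ denotes the number of distinct signers. A compliant party that votes to commit sends its directly signed vote ($|p|=1$) to the escrow contract of each of its incoming assets, arriving before $t_0+\Delta$. It also monitors the escrow contracts of its outgoing assets. Whenever a new vote of some party (with path signature $p$) is accepted there, it appends its own signature and forwards the vote to the escrow contracts of all its incoming assets, unless it has already done so for that voter. (It may also send votes to other contracts.) A contract accepts a vote of $v$ with path signature $p$ if and only if it arrives before time $t_0+|p|\cdot\Delta$, all signers in $p$ are distinct members of $\mathit{plist}$, and all signatures are valid and attest to a vote from $v$. 6. *Release or refund.* When an escrow contract has accepted a commit vote from every party in $\mathit{plist}$, it releases its escrowed asset $a$ to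 $C(a)$, so the tentative transfers of $a$ become permanent. If it has not accepted a vote from every party by time $t_0+N\cdot\Delta$, it times out and refunds $a$ to $A(a)$, so no transfer of $a$ takes place. *)

theory Defs
  imports Complex_Main "HOL-Library.Sublist" "Graph_Theory.Digraph_Component"
begin

section \<open>Deals\<close>

record ('p, 'a) transfer =
  sender :: 'p
  asset :: 'a
  receiver :: 'p

text \<open>
  A deal is a duplicate-free list of transfers. The order matters only among the transfers of one
  asset: it is the order in which a relayed asset passes from hand to hand. The record below is the
  information distributed in the clearing step; \<open>t0\<close> is the start of the commit phase and \<open>delta\<close>
  the bound on the propagation time.
\<close>

record ('p, 'a) deal_info =
  deal :: "('p, 'a) transfer list"
  plist :: "'p list"
  t0 :: real
  delta :: real

definition route :: "('p, 'a) deal_info \<Rightarrow> 'a \<Rightarrow> ('p, 'a) transfer list" where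
  "route D a = filter (\<lambda>x. asset x = a) (deal D)"

definition incoming_assets :: "('p, 'a) deal_info \<Rightarrow> 'p \<Rightarrow> 'a set" where
  "incoming_assets D P = asset ` {x \<in> set (deal D). receiver x = P}"

definition outgoing_assets :: "('p, 'a) deal_info \<Rightarrow> 'p \<Rightarrow> 'a set" where
  "outgoing_assets D P = asset ` {x \<in> set (deal D). sender x = P}"

definition deal_digraph ::
  "('p, 'a) deal_info \<Rightarrow> ('p, ('p, 'a) transfer) pre_digraph" where
  "deal_digraph D =
     \<lparr>verts = set (plist D), arcs = set (deal D), tail = sender, head = receiver\<rparr>"

definition well_formed :: "('p, 'a) deal_info \<Rightarrow> bool" where
  "well_formed D \<longleftrightarrow> strongly_connected (deal_digraph D)"

text \<open>
  Since an asset has exactly one owner at a time, its transfers form a chain that starts at its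
  initial owner. A chain may return to a party it has already visited.
\<close>

definition deal_spec :: "('a \<Rightarrow> 'p) \<Rightarrow> ('p, 'a) deal_info \<Rightarrow> bool" where
  "deal_spec own D \<longleftrightarrow>
     distinct (plist D) \<and> distinct (deal D) \<and>
     (\<forall>x \<in> set (deal D). sender x \<in> set (plist D) \<and> receiver x \<in> set (plist D)) \<and>
     (\<forall>a. route D a \<noteq> [] \<longrightarrow> sender (hd (route D a)) = own a) \<and>
     (\<forall>a i. Suc i < length (route D a) \<longrightarrow>
        receiver (route D a ! i) = sender (route D a ! Suc i))"

type_synonym 'a payoff = "'a set \<times> 'a set"

definition payoff_of :: "('p, 'a) transfer set \<Rightarrow> 'p \<Rightarrow> 'a payoff" where
  "payoff_of T P = (asset ` {x \<in> T. receiver x = P}, asset ` {x \<in> T. sender x = P})"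

definition ALL_payoff :: "('p, 'a) deal_info \<Rightarrow> 'p \<Rightarrow> 'a payoff" where
  "ALL_payoff D P = payoff_of (set (deal D)) P"


section \<open>Escrow contracts\<close>

text \<open>
  Signatures are symbolic: \<open>Sig P v\<close> is the signature of \<open>P\<close> attesting that \<open>v\<close> votes to
  commit. The deal need not be mentioned, as deal identifiers are unique and messages of other deals
  cannot be replayed.
\<close>

datatype 'p signature = Sig (signer: 'p) (attested: 'p)

definition signers :: "'p signature list \<Rightarrow> 'p set" where
  "signers p = signer ` set p"

datatype ('p, 'a) message =
    Escrow "('p, 'a) deal_info"
  | Transfer 'p
  | Vote 'p "'p signature list"

text \<open>Arrival time at the contract, sender, message.\<close>

type_synonym ('p, 'a) entry = "real \<times> 'p \<times> ('p, 'a) message"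

record ('p, 'a) escrow =
  info :: "('p, 'a) deal_info"
  abort_owner :: 'p
  commit_owner :: 'p
  tentative :: "('p, 'a) transfer list"
  voted :: "'p set"

text \<open>
  The asset is owned by its initial owner in state \<open>Unescrowed\<close>, by the contract in state
  \<open>Escrowed\<close>, by \<open>commit_owner\<close> in state \<open>Released\<close> and by \<open>abort_owner\<close> in state \<open>Refunded\<close>.
\<close>

datatype ('p, 'a) contract =
    Unescrowed
  | Escrowed "('p, 'a) escrow"
  | Released "('p, 'a) escrow"
  | Refunded "('p, 'a) escrow"

definition valid_vote ::
  "('p, 'a) deal_info \<Rightarrow> real \<Rightarrow> 'p \<Rightarrow> 'p signature list \<Rightarrow> bool" where
  "valid_vote D t v p \<longleftrightarrow>
     t < t0 D + real (card (signers p)) * delta D \<and>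
     p \<noteq> [] \<and> signer (hd p) = v \<and>
     distinct (map signer p) \<and> signers p \<subseteq> set (plist D) \<and>
     (\<forall>s \<in> set p. attested s = v)"

fun expire :: "real \<Rightarrow> ('p, 'a) contract \<Rightarrow> ('p, 'a) contract" where
  "expire t (Escrowed e) =
     (if t0 (info e) + real (length (plist (info e))) * delta (info e) \<le> t
      then Refunded e else Escrowed e)"
| "expire t c = c"

fun handle ::
  "'p \<Rightarrow> 'a \<Rightarrow> ('p, 'a) entry \<Rightarrow> ('p, 'a) contract \<Rightarrow> ('p, 'a) contract" where
  "handle own a (t, P, Escrow D) Unescrowed =
     (if P = own \<and> P \<in> set (plist D)
      then Escrowed \<lparr>info = D, abort_owner = P, commit_owner = P, tentative = [], voted = {}\<rparr>
      else Unescrowed)"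
| "handle own a (t, P, Transfer Q) (Escrowed e) =
     (if P = commit_owner e \<and> Q \<in> set (plist (info e))
      then Escrowed (e\<lparr>commit_owner := Q,
                      tentative := tentative e @ [\<lparr>sender = P, asset = a, receiver = Q\<rparr>]\<rparr>)
      else Escrowed e)"
| "handle own a (t, P, Vote v p) (Escrowed e) =
     (if valid_vote (info e) t v p
      then (let e' = e\<lparr>voted := insert v (voted e)\<rparr>
            in if set (plist (info e)) \<subseteq> voted e' then Released e' else Escrowed e')
      else Escrowed e)"
| "handle own a m c = c"

definition process ::
  "'p \<Rightarrow> 'a \<Rightarrow> ('p, 'a) entry list \<Rightarrow> ('p, 'a) contract" where
  "process own a ms = fold (\<lambda>m c. handle own a m (expire (fst m) c)) ms Unescrowed"


section \<open>Executions\<close>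

text \<open>
  \<open>ledger E a\<close> lists, in order of arrival, the messages of this deal received by the escrow contract
  of asset \<open>a\<close>; the sender is authenticated but otherwise arbitrary. \<open>validation_time E P\<close> is the
  moment at which \<open>P\<close> performs its validation step, and \<open>acceptable E P\<close> are the payoffs that \<open>P\<close>
  deems acceptable.
\<close>

record ('p, 'a) execution =
  initial_owner :: "'a \<Rightarrow> 'p"
  ledger :: "'a \<Rightarrow> ('p, 'a) entry list"
  validation_time :: "'p \<Rightarrow> real"
  acceptable :: "'p \<Rightarrow> 'a payoff \<Rightarrow> bool"

definition contract_before ::
  "('p, 'a) execution \<Rightarrow> 'a \<Rightarrow> nat \<Rightarrow> ('p, 'a) contract" where
  "contract_before E a i =
     expire (fst (ledger E a ! i)) (process (initial_owner E a) a (take i (ledger E a)))"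

definition contract_at ::
  "('p, 'a) execution \<Rightarrow> 'a \<Rightarrow> real \<Rightarrow> ('p, 'a) contract" where
  "contract_at E a t =
     expire t (process (initial_owner E a) a (filter (\<lambda>m. fst m \<le> t) (ledger E a)))"

definition vote_accepted ::
  "('p, 'a) execution \<Rightarrow> 'a \<Rightarrow> real \<Rightarrow> 'p \<Rightarrow> 'p signature list \<Rightarrow> bool" where
  "vote_accepted E a t v p \<longleftrightarrow>
     (\<exists>i P e. i < length (ledger E a) \<and> ledger E a ! i = (t, P, Vote v p) \<and>
        contract_before E a i = Escrowed e \<and> valid_vote (info e) t v p)"

definition tentative_transfers ::
  "('p, 'a) execution \<Rightarrow> real \<Rightarrow> ('p, 'a) transfer set" where
  "tentative_transfers E t =
     {x. \<exists>e. contract_at E (asset x) t = Escrowed e \<and> x \<in> set (tentative e)}"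

definition permanent_transfers :: "('p, 'a) execution \<Rightarrow> ('p, 'a) transfer set" where
  "permanent_transfers E =
     {x. \<exists>t e. contract_at E (asset x) t = Released e \<and> x \<in> set (tentative e)}"

definition payoff ::
  "('p, 'a) deal_info \<Rightarrow> ('p, 'a) execution \<Rightarrow> 'p \<Rightarrow> 'a payoff" where
  "payoff D E P = payoff_of (set (deal D) \<inter> permanent_transfers E) P"


section \<open>Compliance\<close>

definition follows_escrow ::
  "('p, 'a) deal_info \<Rightarrow> ('p, 'a) execution \<Rightarrow> 'p \<Rightarrow> bool" where
  "follows_escrow D E P \<longleftrightarrow>
     (\<forall>a \<in> outgoing_assets D P. initial_owner E a = P \<longrightarrow>
        (\<exists>t. (t, P, Escrow D) \<in> set (ledger E a))) \<and>
     (\<forall>a t D'. (t, P, Escrow D') \<in> set (ledger E a) \<longrightarrow>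
        a \<in> outgoing_assets D P \<and> initial_owner E a = P \<and> D' = D)"

text \<open>
  \<open>P\<close> performs exactly its own transfers of the deal, each when it is the next one on the route of
  its asset.
\<close>

definition follows_transfer ::
  "('p, 'a) deal_info \<Rightarrow> ('p, 'a) execution \<Rightarrow> 'p \<Rightarrow> bool" where
  "follows_transfer D E P \<longleftrightarrow>
     (\<forall>x t e. sender x = P \<longrightarrow> t < validation_time E P \<longrightarrow>
        contract_at E (asset x) t = Escrowed e \<longrightarrow> info e = D \<longrightarrow>
        prefix (tentative e @ [x]) (route D (asset x)) \<longrightarrow>
        (\<exists>s > t. (s, P, Transfer (receiver x)) \<in> set (ledger E (asset x)))) \<and>
     (\<forall>a i t Q. i < length (ledger E a) \<longrightarrow> ledger E a ! i = (t, P, Transfer Q) \<longrightarrow>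
        (\<exists>e. contract_before E a i = Escrowed e \<and> info e = D \<and>
           prefix (tentative e @ [\<lparr>sender = P, asset = a, receiver = Q\<rparr>]) (route D a)))"

text \<open>The check of the validation step; a compliant party votes iff it succeeds.\<close>

definition validates ::
  "('p, 'a) deal_info \<Rightarrow> ('p, 'a) execution \<Rightarrow> 'p \<Rightarrow> bool" where
  "validates D E P \<longleftrightarrow>
     (\<forall>a \<in> incoming_assets D P.
        \<exists>e. contract_at E a (validation_time E P) = Escrowed e \<and> info e = D) \<and>
     acceptable E P
       (payoff_of (set (deal D) \<inter> tentative_transfers E (validation_time E P)) P)"

text \<open>
  The forwarding duty, first part: for every vote that \<open>P\<close> sees accepted on an outgoing asset,
  \<open>P\<close> has forwarded that vote, or a vote of the same voter accepted no later, to all its incoming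
  assets (``unless it has already done so for that voter''). Its own vote \<open>P\<close> has already sent to
  these contracts, and a path that contains its signature is one it has already forwarded; that the
  latter is really so follows from the second part and from unforgeability.

  \<open>P\<close> starts monitoring when it has validated, hence the maximum in the synchrony bound: a vote
  accepted at time \<open>t\<close> is forwarded by \<open>t + delta\<close>, or, if it was accepted before \<open>P\<close> validated,
  within \<open>delta\<close> of the validation.

  The second part says that \<open>P\<close> sends no votes (to any contract) other than its own directly signed
  vote and those that it forwards from outgoing assets.
\<close>

definition follows_commit ::
  "('p, 'a) deal_info \<Rightarrow> ('p, 'a) execution \<Rightarrow> 'p \<Rightarrow> bool" where
  "follows_commit D E P \<longleftrightarrow>
     (validates D E P \<longrightarrow>
        (\<forall>b \<in> incoming_assets D P.
           \<exists>t. validation_time E P < t \<and> t < t0 D + delta D \<and>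
             (t, P, Vote P [Sig P P]) \<in> set (ledger E b)) \<and>
        (\<forall>a \<in> outgoing_assets D P. \<forall>t v p.
           vote_accepted E a t v p \<longrightarrow> v \<noteq> P \<longrightarrow> P \<notin> signers p \<longrightarrow>
           (\<exists>a' \<in> outgoing_assets D P. \<exists>t' p'.
              t' \<le> t \<and> vote_accepted E a' t' v p' \<and> P \<notin> signers p' \<and>
              (\<forall>b \<in> incoming_assets D P.
                 \<exists>s. validation_time E P < s \<and> t' \<le> s \<and>
                   s \<le> max t' (validation_time E P) + delta D \<and>
                   (s, P, Vote v (p' @ [Sig P v])) \<in> set (ledger E b))))) \<and>
     (\<forall>a t v p. (t, P, Vote v p) \<in> set (ledger E a) \<longrightarrow>
        (v = P \<and> p = [Sig P P] \<and> validates D E P \<and> validation_time E P < t) \<or>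
        (v \<noteq> P \<and>
         (\<exists>a' \<in> outgoing_assets D P. \<exists>t' p'.
            t' \<le> t \<and> vote_accepted E a' t' v p' \<and> P \<notin> signers p' \<and> p = p' @ [Sig P v])))"

definition compliant ::
  "('p, 'a) deal_info \<Rightarrow> ('p, 'a) execution \<Rightarrow> 'p \<Rightarrow> bool" where
  "compliant D E P \<longleftrightarrow>
     follows_escrow D E P \<and> follows_transfer D E P \<and> follows_commit D E P"

definition willing_to_accept ::
  "('p, 'a) deal_info \<Rightarrow> ('p, 'a) execution \<Rightarrow> 'p \<Rightarrow> bool" where
  "willing_to_accept D E P \<longleftrightarrow> acceptable E P (ALL_payoff D P)"


section \<open>Executions of the timelock protocol\<close>

text \<open>
  A compliant party discloses its signatures only in the votes that it sends to contracts. So a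
  signature of it that arrives at some contract has, by then, been sent to a contract by that party.
\<close>

definition unforgeable :: "('p, 'a) deal_info \<Rightarrow> ('p, 'a) execution \<Rightarrow> bool" where
  "unforgeable D E \<longleftrightarrow>
     (\<forall>P \<in> set (plist D). compliant D E P \<longrightarrow>
        (\<forall>a t R v p w. (t, R, Vote v p) \<in> set (ledger E a) \<longrightarrow> Sig P w \<in> set p \<longrightarrow>
           (\<exists>a' t' p'. t' \<le> t \<and> (t', P, Vote w p') \<in> set (ledger E a') \<and> Sig P w \<in> set p')))"

text \<open>
  The time \<open>t0\<close> is far enough in the future: a compliant party validates before \<open>t0\<close>, at a time when
  the compliant parties have finished the escrow and transfer steps for the assets it deals with.
\<close>

definition setup_in_time :: "('p, 'a) deal_info \<Rightarrow> ('p, 'a) execution \<Rightarrow> bool" where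
  "setup_in_time D E \<longleftrightarrow>
     (\<forall>P \<in> set (plist D). compliant D E P \<longrightarrow>
        validation_time E P < t0 D \<and>
        (\<forall>a \<in> incoming_assets D P \<union> outgoing_assets D P. \<forall>t R m.
           (t, R, m) \<in> set (ledger E a) \<longrightarrow> R \<in> set (plist D) \<longrightarrow> compliant D E R \<longrightarrow>
           (\<forall>v p. m \<noteq> Vote v p) \<longrightarrow> t < validation_time E P))"

definition timelock_execution ::
  "('p, 'a) deal_info \<Rightarrow> ('p, 'a) execution \<Rightarrow> bool" where
  "timelock_execution D E \<longleftrightarrow>
     deal_spec (initial_owner E) D \<and> delta D > 0 \<and>
     (\<forall>a. sorted (map fst (ledger E a))) \<and>
     unforgeable D E \<and> setup_in_time D E"

end

theory Submission
  imports Defs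
begin

text \<open>
  All escrow and transfer messages for an asset arrive before any of its parties validates, and when
  the last of them has been processed the route is complete, since otherwise the next sender would
  still owe a transfer. No contract is released before a party validates, since that party's vote is
  missing; so everybody sees ALL as the proposed payoff and votes. A vote of \<open>v\<close> accepted at an
  outgoing asset of \<open>W\<close> with path \<open>p\<close>, before time \<open>t0 + |p| delta\<close>, reaches the incoming assets of
  \<open>W\<close> with a path longer by one and at most \<open>delta\<close> later, hence in time. So the vote of \<open>v\<close>
  spreads against the direction of the arcs, and by strong connectivity it reaches every contract.
\<close>

section \<open>Escrow contracts\<close>

text \<open>Forgets whether the asset is still held, released or refunded. Expiry changes only that
  tag, so facts about \<open>info\<close>, \<open>tentative\<close> and \<open>voted\<close> pass
  through it.\<close>

fun escrow_of :: "('p, 'a) contract \<Rightarrow> ('p, 'a) escrow option" where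
  "escrow_of Unescrowed = None"
| "escrow_of (Escrowed e) = Some e"
| "escrow_of (Released e) = Some e"
| "escrow_of (Refunded e) = Some e"

lemma escrow_of_expire [simp]: "escrow_of (expire t c) = escrow_of c"
  by (cases c) auto

lemma expire_eq_Released_iff [simp]: "expire t c = Released e \<longleftrightarrow> c = Released e"
  by (cases c) auto

text \<open>Elimination rule for one message: every ineffective combination of message and state
  falls into \<open>idle\<close>, so inductions over a ledger treat only the messages that change
  something.\<close>

lemma handle_cases:
  obtains (idle) "handle own a (t, P, m) c = c"
  | (escrow) D where "c = Unescrowed" "m = Escrow D" "P = own" "own \<in> set (plist D)"
      "handle own a (t, P, m) c =
        Escrowed \<lparr>info = D, abort_owner = own, commit_owner = own, tentative = [], voted = {}\<rparr>"
  | (transfer) e Q where "c = Escrowed e" "m = Transfer Q" "P = commit_owner e"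
      "Q \<in> set (plist (info e))"
      "handle own a (t, P, m) c = Escrowed (e\<lparr>commit_owner := Q,
        tentative := tentative e @ [\<lparr>sender = P, asset = a, receiver = Q\<rparr>]\<rparr>)"
  | (vote) e v p where "c = Escrowed e" "m = Vote v p" "valid_vote (info e) t v p"
      "\<not> set (plist (info e)) \<subseteq> insert v (voted e)"
      "handle own a (t, P, m) c = Escrowed (e\<lparr>voted := insert v (voted e)\<rparr>)"
  | (release) e v p where "c = Escrowed e" "m = Vote v p" "valid_vote (info e) t v p"
      "set (plist (info e)) \<subseteq> insert v (voted e)"
      "handle own a (t, P, m) c = Released (e\<lparr>voted := insert v (voted e)\<rparr>)"
proof (cases c)
  case Unescrowed
  show ?thesis
  proof (cases "\<exists>D. m = Escrow D \<and> P = own \<and> own \<in> set (plist D)")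
    case True
    then show ?thesis using Unescrowed that(2) by auto
  next
    case False
    then have "handle own a (t, P, m) c = c" using Unescrowed by (cases m) auto
    then show ?thesis by (rule that(1))
  qed
next
  case (Escrowed e)
  show ?thesis
  proof (cases m)
    case (Escrow D)
    then have "handle own a (t, P, m) c = c" using Escrowed by simp
    then show ?thesis by (rule that(1))
  next
    case (Transfer Q)
    show ?thesis
    proof (cases "P = commit_owner e \<and> Q \<in> set (plist (info e))")
      case True
      then show ?thesis using Escrowed Transfer by (intro that(3)[of e Q]) auto
    next
      case False
      then have "handle own a (t, P, m) c = c" using Escrowed Transfer by auto
      then show ?thesis by (rule that(1))
    qed
  next
    case (Vote v p)
    consider "\<not> valid_vote (info e) t v p"
      | "valid_vote (info e) t v p" "\<not> set (plist (info e)) \<subseteq> insert v (voted e)"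
      | "valid_vote (info e) t v p" "set (plist (info e)) \<subseteq> insert v (voted e)"
      by blast
    then show ?thesis
    proof cases
      case 1
      then have "handle own a (t, P, m) c = c" using Escrowed Vote by simp
      then show ?thesis by (rule that(1))
    next
      case 2
      then show ?thesis by (intro that(4)[OF Escrowed Vote]) (simp_all add: Escrowed Vote)
    next
      case 3
      then show ?thesis by (intro that(5)[OF Escrowed Vote]) (simp_all add: Escrowed Vote)
    qed
  qed
next
  case (Released e)
  then have "handle own a (t, P, m) c = c" by simp
  then show ?thesis by (rule that(1))
next
  case (Refunded e)
  then have "handle own a (t, P, m) c = c" by simp
  then show ?thesis by (rule that(1))
qed

section \<open>Message processing: monotonicity, release and refund\<close>

lemma process_Nil [simp]: "process own a [] = Unescrowed"
  by (simp add: process_def)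

lemma process_snoc:
  "process own a (ms @ [m]) = handle own a m (expire (fst m) (process own a ms))"
  by (simp add: process_def)

lemma escrow_of_handle_mono:
  assumes "escrow_of c = Some e"
  obtains e' where "escrow_of (handle own a m c) = Some e'"
    "voted e \<subseteq> voted e'" "prefix (tentative e) (tentative e')"
proof -
  obtain t P k where m: "m = (t, P, k)" by (cases m)
  show ?thesis
    unfolding m by (cases rule: handle_cases[of own a t P k c]) (use assms that m in auto)
qed

lemma escrow_of_process_mono:
  assumes "escrow_of (process own a ms) = Some e"
  shows "\<exists>e'. escrow_of (process own a (ms @ ms')) = Some e' \<and>
    voted e \<subseteq> voted e' \<and> prefix (tentative e) (tentative e')"
proof (induction ms' rule: rev_induct)
  case Nil
  then show ?case using assms by simp
next
  case (snoc m ms')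
  then obtain e' where e': "escrow_of (expire (fst m) (process own a (ms @ ms'))) = Some e'"
    "voted e \<subseteq> voted e'" "prefix (tentative e) (tentative e')" by auto
  obtain e'' where "escrow_of (process own a (ms @ ms' @ [m])) = Some e''"
    "voted e' \<subseteq> voted e''" "prefix (tentative e') (tentative e'')"
    using escrow_of_handle_mono[OF e'(1)] unfolding append.assoc[symmetric] process_snoc by metis
  then show ?case using e'(2,3) by (auto intro: prefix_order.order_trans)
qed

lemma escrow_of_process_take_mono:
  assumes "escrow_of (process own a (take i ms)) = Some e" "i \<le> j"
  obtains e' where "escrow_of (process own a (take j ms)) = Some e'"
    "voted e \<subseteq> voted e'" "prefix (tentative e) (tentative e')"
proof -
  have "take j ms = take i ms @ take (j - i) (drop i ms)"
    using assms(2) by (metis le_add_diff_inverse take_add)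
  then show ?thesis using escrow_of_process_mono[OF assms(1)] that by metis
qed

text \<open>Completeness is checked in the very step that records a vote, and a fresh escrow is
  incomplete because \<open>plist\<close> contains the owner. A refund starts from an incomplete
  escrow and freezes \<open>voted\<close>.\<close>

lemma released_iff_all_voted:
  assumes "escrow_of (process own a ms) = Some e"
  shows "process own a ms = Released e \<longleftrightarrow> set (plist (info e)) \<subseteq> voted e"
  using assms
proof (induction ms arbitrary: e rule: rev_induct)
  case Nil
  then show ?case by simp
next
  case (snoc m ms)
  obtain t P k where m: "m = (t, P, k)" by (cases m)
  let ?c = "expire t (process own a ms)"
  have IH: "?c = Released e \<longleftrightarrow> set (plist (info e)) \<subseteq> voted e" if "escrow_of ?c = Some e" for e
    using snoc.IH[of e] that by simp
  show ?case
    by (cases rule: handle_cases[of own a t P k ?c])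
      (use snoc.prems IH in \<open>auto simp: process_snoc m\<close>)
qed

text \<open>The timeout depends on \<open>info\<close> alone, which no message changes. Processing
  expires a contract only when a message arrives; the expiry at query time in
  \<open>contract_at\<close> has to be excluded separately.\<close>

lemma not_refunded_before_timeout:
  assumes "escrow_of (process own a ms) = Some e"
    and "\<forall>m \<in> set ms. fst m < t0 (info e) + real (length (plist (info e))) * delta (info e)"
  shows "process own a ms \<noteq> Refunded e"
  using assms
proof (induction ms arbitrary: e rule: rev_induct)
  case Nil
  then show ?case by simp
next
  case (snoc m ms)
  obtain t P k where m: "m = (t, P, k)" by (cases m)
  show ?case
  proof
    assume ref: "process own a (ms @ [m]) = Refunded e"
    then have "expire t (process own a ms) = Refunded e"
      by (cases rule: handle_cases[of own a t P k "expire t (process own a ms)"])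
        (auto simp: process_snoc m)
    then show False
      using snoc.IH[of e] snoc.prems m by (cases "process own a ms") (auto split: if_splits)
  qed
qed

section \<open>Contract states by time and by ledger position; accepted votes\<close>

lemma filter_le_eq_take:
  assumes "sorted (map fst l)"
  shows "filter (\<lambda>m. fst m \<le> t) l = take (length (filter (\<lambda>m. fst m \<le> t) l)) l"
  using assms
proof (induction l)
  case (Cons m l)
  show ?case
  proof (cases "fst m \<le> t")
    case False
    then have "filter (\<lambda>m. fst m \<le> t) (m # l) = []"
      using Cons.prems by (auto simp: filter_empty_conv)
    then show ?thesis by (metis list.size(3) take0)
  qed (use Cons in simp)
qed simp

text \<open>Validation looks at contracts by time, while inductions run over ledger positions; this
  translates between the two. Entries arriving exactly at \<open>t\<close> are included.\<close>

lemma contract_at_eq_take: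
  assumes "sorted (map fst (ledger E a))"
  obtains n where "n \<le> length (ledger E a)"
    "\<And>i. i < length (ledger E a) \<Longrightarrow> i < n \<longleftrightarrow> fst (ledger E a ! i) \<le> t"
    "contract_at E a t = expire t (process (initial_owner E a) a (take n (ledger E a)))"
proof
  let ?l = "ledger E a"
  let ?n = "length (filter (\<lambda>m. fst m \<le> t) ?l)"
  show "?n \<le> length ?l" by simp
  show "contract_at E a t = expire t (process (initial_owner E a) a (take ?n ?l))"
    unfolding contract_at_def using filter_le_eq_take[OF assms] by metis
  show "i < ?n \<longleftrightarrow> fst (?l ! i) \<le> t" if i: "i < length ?l" for i
  proof
    assume "i < ?n"
    then have "?l ! i \<in> set (take ?n ?l)"
      using i by (auto simp: in_set_conv_nth)
    then show "fst (?l ! i) \<le> t"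
      using filter_le_eq_take[OF assms, of t]
      by (metis (no_types, lifting) mem_Collect_eq set_filter)
  next
    assume le: "fst (?l ! i) \<le> t"
    \<comment> \<open>By sortedness the first \<open>Suc i\<close> entries all pass the filter, so
      its length exceeds \<open>i\<close>.\<close>
    have "\<forall>m \<in> set (take (Suc i) ?l). fst m \<le> t"
    proof
      fix m assume "m \<in> set (take (Suc i) ?l)"
      then obtain j where "j \<le> i" "m = ?l ! j"
        using i by (auto simp: in_set_conv_nth less_Suc_eq_le)
      then show "fst m \<le> t"
        using sorted_nth_mono[OF assms, of j i] i le by simp
    qed
    then have "filter (\<lambda>m. fst m \<le> t) (take (Suc i) ?l) = take (Suc i) ?l"
      by (simp add: filter_id_conv)
    then have "length (filter (\<lambda>m. fst m \<le> t) (take (Suc i) ?l)) = Suc i"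
      using i by simp
    moreover have "?n = length (filter (\<lambda>m. fst m \<le> t) (take (Suc i) ?l)) +
        length (filter (\<lambda>m. fst m \<le> t) (drop (Suc i) ?l))"
      by (simp flip: length_append filter_append)
    ultimately show "i < ?n" by simp
  qed
qed

lemma process_take_Suc:
  assumes "i < length (ledger E a)"
  shows "process (initial_owner E a) a (take (Suc i) (ledger E a)) =
    handle (initial_owner E a) a (ledger E a ! i) (contract_before E a i)"
  using assms by (simp add: take_Suc_conv_app_nth process_snoc contract_before_def)

text \<open>A name enters \<open>voted\<close> only through a valid vote met in state
  \<open>Escrowed\<close>, which is what \<open>vote_accepted\<close> describes. The bound on
  \<open>i\<close> later limits the time of acceptance.\<close>

lemma vote_accepted_if_voted:
  assumes "escrow_of (process (initial_owner E a) a (take n (ledger E a))) = Some e"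
    and "v \<in> voted e" "n \<le> length (ledger E a)"
  shows "\<exists>i p. i < n \<and> vote_accepted E a (fst (ledger E a ! i)) v p"
  using assms
proof (induction n arbitrary: e)
  case 0
  then show ?case by simp
next
  case (Suc n)
  obtain t P k where m: "ledger E a ! n = (t, P, k)" by (metis prod_cases3)
  have IH: "\<exists>i p. i < n \<and> vote_accepted E a (fst (ledger E a ! i)) v p"
    if "escrow_of (contract_before E a n) = Some e'" "v \<in> voted e'" for e'
    using Suc.IH[of e'] Suc.prems that by (simp add: contract_before_def)
  have acc: "vote_accepted E a t w p"
    if "contract_before E a n = Escrowed e'" "k = Vote w p" "valid_vote (info e') t w p" for e' w p
    using that m Suc.prems(3) unfolding vote_accepted_def by (metis Suc_le_lessD)
  have esc: "escrow_of (handle (initial_owner E a) a (t, P, k) (contract_before E a n)) = Some e"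
    using Suc.prems by (simp add: process_take_Suc flip: m)
  have "(\<exists>e'. escrow_of (contract_before E a n) = Some e' \<and> v \<in> voted e') \<or>
    (\<exists>p. vote_accepted E a t v p)"
  proof (cases rule: handle_cases[of "initial_owner E a" a t P k "contract_before E a n"])
    case (vote e' w p)
    then show ?thesis using esc Suc.prems(2) acc[OF vote(1-3)] by auto
  next
    case (release e' w p)
    then show ?thesis using esc Suc.prems(2) acc[OF release(1-3)] by auto
  qed (use esc Suc.prems(2) in auto)
  then show ?case using IH m by (metis fst_conv less_Suc_eq)
qed

lemma voted_if_vote_accepted:
  assumes "vote_accepted E a t v p"
  obtains e where "escrow_of (process (initial_owner E a) a (ledger E a)) = Some e" "v \<in> voted e"
proof -
  obtain i P e where i: "i < length (ledger E a)" "ledger E a ! i = (t, P, Vote v p)"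
    "contract_before E a i = Escrowed e" "valid_vote (info e) t v p"
    using assms by (auto simp: vote_accepted_def)
  then obtain e' where
    "escrow_of (process (initial_owner E a) a (take (Suc i) (ledger E a))) = Some e'"
    "v \<in> voted e'"
    by (simp add: process_take_Suc Let_def split: if_splits)
  then show ?thesis
    using escrow_of_process_take_mono[of "initial_owner E a" a "Suc i" "ledger E a" e'
        "length (ledger E a)"] i(1) that by (metis Suc_leI subsetD take_all_iff order_refl)
qed

section \<open>Executions in which all parties comply\<close>

locale compliant_execution =
  fixes D :: "('p, 'a) deal_info" and E :: "('p, 'a) execution"
  assumes exec: "timelock_execution D E"
    and wf: "well_formed D"
    and compliant: "\<And>P. P \<in> set (plist D) \<Longrightarrow> compliant D E P"
    and willing: "\<And>P. P \<in> set (plist D) \<Longrightarrow> willing_to_accept D E P"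
begin

abbreviation state :: "'a \<Rightarrow> nat \<Rightarrow> ('p, 'a) contract" where
  "state a n \<equiv> process (initial_owner E a) a (take n (ledger E a))"

abbreviation deal_assets :: "'a set" where
  "deal_assets \<equiv> asset ` set (deal D)"

text \<open>A predicate on arrival times, so that the last setup time is a maximum of reals; a vote
  arriving at the same instant satisfies it too. Only senders in \<open>plist\<close> count, as
  \<open>setup_in_time\<close> bounds no others.\<close>

definition setup_message :: "'a \<Rightarrow> real \<Rightarrow> bool" where
  "setup_message a t \<longleftrightarrow>
     (\<exists>R m. (t, R, m) \<in> set (ledger E a) \<and> R \<in> set (plist D) \<and> (\<forall>v p. m \<noteq> Vote v p))"

lemma delta_pos: "delta D > 0"
  using exec by (simp add: timelock_execution_def)

lemma sorted_ledger: "sorted (map fst (ledger E a))"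
  using exec by (simp add: timelock_execution_def)

lemma deal_parties:
  assumes "x \<in> set (deal D)"
  shows "sender x \<in> set (plist D)" "receiver x \<in> set (plist D)"
  using exec assms by (auto simp: timelock_execution_def deal_spec_def)

lemma owner_of_deal_asset:
  assumes "a \<in> deal_assets"
  shows "initial_owner E a \<in> set (plist D)" "a \<in> outgoing_assets D (initial_owner E a)"
proof -
  have ne: "route D a \<noteq> []" using assms by (auto simp: route_def filter_empty_conv)
  then have "sender (hd (route D a)) = initial_owner E a"
    using exec by (auto simp: timelock_execution_def deal_spec_def)
  moreover have "hd (route D a) \<in> set (route D a)" using ne by simp
  then have "hd (route D a) \<in> set (deal D)" "asset (hd (route D a)) = a"
    by (auto simp: route_def)
  ultimately show "initial_owner E a \<in> set (plist D)" "a \<in> outgoing_assets D (initial_owner E a)"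
    using deal_parties(1)[of "hd (route D a)"] by (auto simp: outgoing_assets_def image_iff)
qed

lemma setup_before_validation:
  assumes "P \<in> set (plist D)" "a \<in> incoming_assets D P \<union> outgoing_assets D P" "setup_message a t"
  shows "t < validation_time E P"
  using exec assms compliant
  unfolding timelock_execution_def setup_in_time_def setup_message_def by blast

lemma validation_before_t0: "P \<in> set (plist D) \<Longrightarrow> validation_time E P < t0 D"
  using exec compliant by (auto simp: timelock_execution_def setup_in_time_def)

section \<open>The escrow and transfer phase\<close>

lemma escrow_message:
  assumes "a \<in> deal_assets"
  obtains t where "(t, initial_owner E a, Escrow D) \<in> set (ledger E a)" "setup_message a t"
  using owner_of_deal_asset[OF assms] compliant[of "initial_owner E a"] that
  unfolding compliant_def follows_escrow_def setup_message_def by blast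

text \<open>The three parts need each other: since the commit owner is in \<open>plist\<close>, the
  sender of an effective transfer is compliant and hence extends a prefix of the route; since
  \<open>info\<close> is \<open>D\<close>, the new commit owner is again in
  \<open>plist D\<close>.\<close>

lemma escrow_invariant:
  assumes "a \<in> deal_assets" "n \<le> length (ledger E a)" "escrow_of (state a n) = Some e"
  shows "info e = D \<and> commit_owner e \<in> set (plist D) \<and> prefix (tentative e) (route D a)"
  using assms(2,3)
proof (induction n arbitrary: e)
  case 0
  then show ?case by simp
next
  case (Suc n)
  obtain t P k where m: "ledger E a ! n = (t, P, k)" by (metis prod_cases3)
  have n: "n < length (ledger E a)" using Suc.prems by simp
  then have mem: "(t, P, k) \<in> set (ledger E a)" using m by (metis nth_mem)
  have IH: "info e' = D \<and> commit_owner e' \<in> set (plist D) \<and> prefix (tentative e') (route D a)"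
    if "escrow_of (contract_before E a n) = Some e'" for e'
    using Suc.IH[of e'] Suc.prems that by (simp add: contract_before_def)
  have esc: "escrow_of (handle (initial_owner E a) a (t, P, k) (contract_before E a n)) = Some e"
    using Suc.prems by (simp add: process_take_Suc flip: m)
  show ?case
  proof (cases rule: handle_cases[of "initial_owner E a" a t P k "contract_before E a n"])
    case idle
    then show ?thesis using esc IH by simp
  next
    case (escrow D')
    have "follows_escrow D E P"
      using compliant owner_of_deal_asset[OF assms(1)] escrow by (auto simp: compliant_def)
    then have "D' = D" using mem escrow unfolding follows_escrow_def by blast
    then show ?thesis using escrow esc by auto
  next
    case (transfer e' Q)
    have inv: "info e' = D" "P \<in> set (plist D)" using IH[of e'] transfer by auto
    then have "follows_transfer D E P" using compliant by (auto simp: compliant_def)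
    then have "prefix (tentative e' @ [\<lparr>sender = P, asset = a, receiver = Q\<rparr>]) (route D a)"
      using n m transfer unfolding follows_transfer_def by (metis contract.inject(1))
    then show ?thesis using transfer esc inv by auto
  next
    case (vote e' v p)
    then show ?thesis using IH[of e'] esc by auto
  next
    case (release e' v p)
    then show ?thesis using IH[of e'] esc by auto
  qed
qed

lemma escrowed_after_setup:
  assumes "a \<in> deal_assets" "n \<le> length (ledger E a)"
    and "\<And>i. i < length (ledger E a) \<Longrightarrow> setup_message a (fst (ledger E a ! i)) \<Longrightarrow> i < n"
  obtains e where "escrow_of (state a n) = Some e"
proof -
  obtain t where t: "(t, initial_owner E a, Escrow D) \<in> set (ledger E a)" "setup_message a t"
    using escrow_message[OF assms(1)] .
  then obtain i where i: "i < length (ledger E a)"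
    "ledger E a ! i = (t, initial_owner E a, Escrow D)" by (metis in_set_conv_nth)
  \<comment> \<open>Either the owner's message creates the escrow or one exists already.\<close>
  have "escrow_of (state a (Suc i)) \<noteq> None"
  proof (cases "contract_before E a i")
    case Unescrowed
    then show ?thesis
      using i owner_of_deal_asset(1)[OF assms(1)] by (simp add: process_take_Suc)
  qed (use i in \<open>auto simp: process_take_Suc\<close>)
  moreover have "Suc i \<le> n" using assms(3)[of i] i t by simp
  ultimately show ?thesis using escrow_of_process_take_mono that
    by (metis option.exhaust)
qed

text \<open>The path begins with the signature of \<open>P\<close> on its own vote. By
  unforgeability \<open>P\<close> sent such a vote no later than \<open>t\<close>, which the commit
  rules permit only after validation.\<close>

lemma party_vote_after_validation:
  assumes "P \<in> set (plist D)" "vote_accepted E a t P p"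
  shows "validation_time E P < t"
proof -
  \<comment> \<open>The asset is arbitrary, so the deal recorded by the contract is not known to be
    \<open>D\<close>; only the shape of the path is needed.\<close>
  obtain R and D' :: "('p, 'a) deal_info"
    where mem: "(t, R, Vote P p) \<in> set (ledger E a)" and valid: "valid_vote D' t P p"
    using assms(2) unfolding vote_accepted_def by (metis nth_mem)
  have "hd p = Sig P P" "p \<noteq> []"
    using valid by (auto simp: valid_vote_def intro: signature.expand)
  then have "Sig P P \<in> set p" by (metis hd_in_set)
  then obtain a' t' p' where t': "t' \<le> t" "(t', P, Vote P p') \<in> set (ledger E a')"
    using exec assms(1) compliant mem unfolding timelock_execution_def unforgeable_def by blast
  have "follows_commit D E P" using compliant assms(1) by (auto simp: compliant_def)
  then have "validation_time E P < t'" using t'(2) unfolding follows_commit_def by blast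
  then show ?thesis using t' by simp
qed

lemma t0_less_timeout: "t0 D < t0 D + real (length (plist D)) * delta D"
proof -
  \<comment> \<open>Strong connectivity includes the existence of a vertex.\<close>
  have "plist D \<noteq> []"
    using wf by (auto simp: well_formed_def strongly_connected_def deal_digraph_def)
  then show ?thesis using delta_pos by simp
qed

text \<open>
  The vote of \<open>P\<close>, which does not arrive before its validation, keeps the contract from being
  released.
\<close>

lemma escrowed_until_validation:
  assumes P: "P \<in> set (plist D)" and a: "a \<in> deal_assets" and t: "t \<le> validation_time E P"
    and early: "\<And>s. setup_message a s \<Longrightarrow> s \<le> t"
  obtains n e where "n \<le> length (ledger E a)"
    "\<And>i. i < n \<Longrightarrow> fst (ledger E a ! i) \<le> t" "escrow_of (state a n) = Some e"
    "contract_at E a t = Escrowed e" "info e = D" "prefix (tentative e) (route D a)"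
proof -
  obtain n where n: "n \<le> length (ledger E a)"
    "\<And>i. i < length (ledger E a) \<Longrightarrow> i < n \<longleftrightarrow> fst (ledger E a ! i) \<le> t"
    "contract_at E a t = expire t (state a n)"
    using contract_at_eq_take[OF sorted_ledger] by metis
  obtain e where e: "escrow_of (state a n) = Some e"
    using escrowed_after_setup[OF a n(1)] n(2) early by metis
  have inv: "info e = D" "prefix (tentative e) (route D a)"
    using escrow_invariant[OF a n(1) e] by auto
  \<comment> \<open>This excludes a refund both while messages are processed and by the expiry at
    \<open>t\<close> itself.\<close>
  have before: "t < t0 D + real (length (plist D)) * delta D"
    using t validation_before_t0[OF P] t0_less_timeout by simp
  have "state a n \<noteq> Released e"
  proof
    assume "state a n = Released e"
    then have "P \<in> voted e" using released_iff_all_voted[OF e] inv P by auto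
    then obtain i p where i: "i < n" "vote_accepted E a (fst (ledger E a ! i)) P p"
      using vote_accepted_if_voted[OF e _ n(1)] by blast
    then have "fst (ledger E a ! i) \<le> t" using n(1,2) less_le_trans by blast
    then show False using party_vote_after_validation[OF P i(2)] t by simp
  qed
  moreover have "state a n \<noteq> Refunded e"
  proof (rule not_refunded_before_timeout[OF e], unfold inv, rule ballI)
    fix m assume "m \<in> set (take n (ledger E a))"
    then obtain i where "i < n" "i < length (ledger E a)" "m = ledger E a ! i"
      by (auto simp: in_set_conv_nth)
    then show "fst m < t0 D + real (length (plist D)) * delta D" using n(2)[of i] before by auto
  qed
  ultimately have "state a n = Escrowed e" using e by (cases "state a n") auto
  then have "contract_at E a t = Escrowed e" using n(3) inv before by simp
  moreover have "\<And>i. i < n \<Longrightarrow> fst (ledger E a ! i) \<le> t" using n(1,2) less_le_trans by blast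
  ultimately show ?thesis using that n(1) e inv by blast
qed

lemma tentative_complete:
  assumes a: "a \<in> deal_assets" and n: "n \<le> length (ledger E a)"
    and early: "\<And>i. i < length (ledger E a) \<Longrightarrow> setup_message a (fst (ledger E a ! i)) \<Longrightarrow> i < n"
    and e: "escrow_of (state a n) = Some e"
  shows "tentative e = route D a"
proof -
  define S where "S = {t \<in> fst ` set (ledger E a). setup_message a t}"
  have mem_S: "t \<in> S" if "setup_message a t" for t
    using that by (force simp: S_def setup_message_def)
  have fin: "finite S" by (simp add: S_def)
  have ne: "S \<noteq> {}" using escrow_message[OF a] mem_S by blast
  \<comment> \<open>The arrival time of the last setup message; \<open>S\<close> is nonempty because
    of the escrow message.\<close>
  define T where "T = Max S"
  have T: "setup_message a T" "\<And>s. setup_message a s \<Longrightarrow> s \<le> T"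
    using Max_in[OF fin ne] Max_ge[OF fin] mem_S by (auto simp: T_def S_def)
  \<comment> \<open>Every sender on the route is still bound by its transfer duty at
    \<open>T\<close>.\<close>
  have T_less: "T < validation_time E (sender x)" if "x \<in> set (deal D)" "asset x = a" for x
    using setup_before_validation[OF deal_parties(1)[OF that(1)] _ T(1)] that
    by (auto simp: outgoing_assets_def)
  obtain x0 where x0: "x0 \<in> set (deal D)" "asset x0 = a" using a by blast
  obtain k eT where k: "k \<le> length (ledger E a)"
      "\<And>i. i < k \<Longrightarrow> fst (ledger E a ! i) \<le> T" "escrow_of (state a k) = Some eT"
    and eT: "contract_at E a T = Escrowed eT" "info eT = D" "prefix (tentative eT) (route D a)"
    using escrowed_until_validation[OF deal_parties(1)[OF x0(1)] a] T_less[OF x0] T(2)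
    by (metis less_imp_le)
  have complete: "tentative eT = route D a"
  proof (rule ccontr)
    assume "tentative eT \<noteq> route D a"
    \<comment> \<open>\<open>x\<close> is the first missing transfer. Its sender must still send it
      after \<open>T\<close>, against the maximality of \<open>T\<close>.\<close>
    then obtain x ys where route: "route D a = tentative eT @ x # ys"
      using eT(3) by (metis append_Nil2 neq_Nil_conv prefix_def)
    then have "x \<in> set (route D a)" by simp
    then have x: "x \<in> set (deal D)" "asset x = a" by (auto simp: route_def)
    have "prefix (tentative eT @ [x]) (route D (asset x))" using route x by simp
    moreover have "follows_transfer D E (sender x)"
      using compliant[OF deal_parties(1)[OF x(1)]] by (simp add: compliant_def)
    ultimately obtain s where s: "s > T"
      "(s, sender x, Transfer (receiver x)) \<in> set (ledger E a)"
      using eT T_less[OF x] x(2) unfolding follows_transfer_def by metis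
    then have "setup_message a s"
      using deal_parties(1)[OF x(1)] unfolding setup_message_def by blast
    then show False using T(2) s by fastforce
  qed
  \<comment> \<open>\<open>k\<close> entries give the state at \<open>T\<close>. An entry at
    position \<open>n\<close> inside them would lie after a setup message of time \<open>T\<close>,
    so its own time would be \<open>T\<close>, and \<open>early\<close> would give
    \<open>n < n\<close>.\<close>
  have "k \<le> n"
  proof (rule ccontr)
    assume "\<not> k \<le> n"
    then have less: "n < length (ledger E a)" and le: "fst (ledger E a ! n) \<le> T"
      using k by auto
    obtain i where i: "i < length (ledger E a)" "fst (ledger E a ! i) = T"
      using T(1) unfolding setup_message_def by (metis fst_conv in_set_conv_nth)
    then have "i < n" using early T(1) by blast
    then have "T \<le> fst (ledger E a ! n)"
      using sorted_nth_mono[OF sorted_ledger, of i n a] i less by simp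
    then show False using early[OF less] T(1) le by simp
  qed
  then obtain e' where "escrow_of (state a n) = Some e'" "prefix (tentative eT) (tentative e')"
    using escrow_of_process_take_mono k(3) by metis
  \<comment> \<open>The route is a prefix of \<open>tentative e\<close> by monotonicity from
    \<open>eT\<close>, and conversely by the invariant.\<close>
  then show ?thesis
    using e complete escrow_invariant[OF a n e] by (simp add: prefix_order.antisym)
qed

section \<open>The contracts at and after validation\<close>

lemma asset_of_party:
  assumes "a \<in> incoming_assets D P \<union> outgoing_assets D P"
  shows "a \<in> deal_assets"
  using assms by (auto simp: incoming_assets_def outgoing_assets_def)

text \<open>Sortedness puts all setup messages before position \<open>i\<close>. The time condition
  is void when \<open>i\<close> is the length of the ledger, so the final state is covered as
  well.\<close>

lemma after_validation:
  assumes P: "P \<in> set (plist D)" and a: "a \<in> incoming_assets D P \<union> outgoing_assets D P"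
    and i: "i \<le> length (ledger E a)"
      "i < length (ledger E a) \<Longrightarrow> validation_time E P \<le> fst (ledger E a ! i)"
  obtains e where "escrow_of (state a i) = Some e" "info e = D" "tentative e = route D a"
proof -
  have before: "j < i" if j: "j < length (ledger E a)" "setup_message a (fst (ledger E a ! j))" for j
  proof (rule ccontr)
    assume "\<not> j < i"
    then have "validation_time E P \<le> fst (ledger E a ! j)"
      using i j sorted_nth_mono[OF sorted_ledger, of i j a] by simp
    then show False using setup_before_validation[OF P a j(2)] by simp
  qed
  obtain e where "escrow_of (state a i) = Some e"
    using escrowed_after_setup[OF asset_of_party[OF a] i(1)] before by blast
  then show ?thesis
    using that tentative_complete[OF asset_of_party[OF a] i(1)] before
      escrow_invariant[OF asset_of_party[OF a] i(1)] by blast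
qed

lemma contract_at_validation:
  assumes P: "P \<in> set (plist D)" and a: "a \<in> incoming_assets D P \<union> outgoing_assets D P"
  obtains e where "contract_at E a (validation_time E P) = Escrowed e"
    "info e = D" "tentative e = route D a"
proof -
  let ?t = "validation_time E P"
  have early: "setup_message a s \<Longrightarrow> s \<le> ?t" for s
    using setup_before_validation[OF P a] by fastforce
  obtain n where n: "n \<le> length (ledger E a)"
    "\<And>i. i < length (ledger E a) \<Longrightarrow> i < n \<longleftrightarrow> fst (ledger E a ! i) \<le> ?t"
    "contract_at E a ?t = expire ?t (state a n)"
    using contract_at_eq_take[OF sorted_ledger] by metis
  obtain e where e: "contract_at E a ?t = Escrowed e" "info e = D"
    using escrowed_until_validation[OF P asset_of_party[OF a] order_refl early] by metis
  then have "escrow_of (state a n) = Some e"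
    using n(3) escrow_of_expire escrow_of.simps(2) by metis
  then have "tentative e = route D a"
    using tentative_complete[OF asset_of_party[OF a] n(1)] n(2) early by blast
  then show ?thesis using e that by blast
qed

lemma all_validate:
  assumes P: "P \<in> set (plist D)"
  shows "validates D E P"
proof -
  let ?T = "set (deal D) \<inter> tentative_transfers E (validation_time E P)"
  \<comment> \<open>Transfers that do not involve \<open>P\<close> may be ignored, as
    \<open>payoff_of\<close> for \<open>P\<close> does not look at them.\<close>
  have "x \<in> ?T" if x: "x \<in> set (deal D)" "receiver x = P \<or> sender x = P" for x
  proof -
    have "asset x \<in> incoming_assets D P \<union> outgoing_assets D P"
      using x by (auto simp: incoming_assets_def outgoing_assets_def)
    then obtain e where "contract_at E (asset x) (validation_time E P) = Escrowed e"
      "tentative e = route D (asset x)" using contract_at_validation[OF P] by blast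
    then show ?thesis using x by (auto simp: tentative_transfers_def route_def)
  qed
  then have "{x \<in> ?T. receiver x = P} = {x \<in> set (deal D). receiver x = P}"
    "{x \<in> ?T. sender x = P} = {x \<in> set (deal D). sender x = P}" by blast+
  then have "payoff_of ?T P = ALL_payoff D P" by (simp add: payoff_of_def ALL_payoff_def)
  then show ?thesis
    using contract_at_validation[OF P] willing[OF P]
    unfolding validates_def willing_to_accept_def by (metis UnI1)
qed

section \<open>The spreading of votes in the commit phase\<close>

lemma valid_vote_before_timeout:
  assumes "valid_vote D t v p"
  shows "t < t0 D + real (length (plist D)) * delta D"
proof -
  \<comment> \<open>Path signers are members of \<open>plist\<close>, so no vote deadline lies
    beyond the timeout.\<close>
  have "card (signers p) \<le> card (set (plist D))"
    using assms by (auto simp: valid_vote_def intro: card_mono)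
  then have "card (signers p) \<le> length (plist D)" using card_length le_trans by blast
  then have "real (card (signers p)) * delta D \<le> real (length (plist D)) * delta D"
    using delta_pos by (simp add: mult_right_mono)
  then show ?thesis using assms by (simp add: valid_vote_def)
qed

text \<open>A contract that is already released when the vote arrives has accepted a vote of \<open>v\<close> earlier.\<close>

lemma valid_vote_accepted:
  assumes W: "W \<in> set (plist D)" and b: "b \<in> incoming_assets D W"
    and mem: "(s, R, Vote v p) \<in> set (ledger E b)"
    and s: "validation_time E W < s" and valid: "valid_vote D s v p"
  shows "\<exists>t p. vote_accepted E b t v p"
proof -
  obtain i where i: "i < length (ledger E b)" "ledger E b ! i = (s, R, Vote v p)"
    using mem by (metis in_set_conv_nth)
  \<comment> \<open>A vote reaching an unescrowed contract would be lost; arrival after the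
    validation of \<open>W\<close> excludes this.\<close>
  obtain e where e: "escrow_of (state b i) = Some e" "info e = D"
    using after_validation[OF W _ less_imp_le[OF i(1)]] b i(2) s
    by (metis UnI1 fst_conv less_imp_le)
  have timeout: "s < t0 D + real (length (plist D)) * delta D"
    using valid_vote_before_timeout[OF valid] .
  have "state b i \<noteq> Refunded e"
  proof (rule not_refunded_before_timeout[OF e(1)], unfold e(2), rule ballI)
    fix m assume "m \<in> set (take i (ledger E b))"
    then obtain j where "j < i" "m = ledger E b ! j" by (auto simp: in_set_conv_nth)
    then show "fst m < t0 D + real (length (plist D)) * delta D"
      using sorted_nth_mono[OF sorted_ledger, of j i b] i timeout by simp
  qed
  then consider "state b i = Escrowed e" | "state b i = Released e"
    using e(1) by (cases "state b i") auto
  then show ?thesis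
  proof cases
    case 1
    then have "contract_before E b i = Escrowed e"
      using i(2) e(2) timeout by (simp add: contract_before_def)
    then show ?thesis using i valid e(2) unfolding vote_accepted_def by metis
  next
    case 2
    have "signer (hd p) = v" "p \<noteq> []" "signers p \<subseteq> set (plist D)"
      using valid by (auto simp: valid_vote_def)
    then have "v \<in> set (plist D)" by (auto simp: signers_def)
    then have "v \<in> voted e" using 2 e released_iff_all_voted[OF e(1)] by auto
    then show ?thesis using vote_accepted_if_voted[OF e(1)] i(1) less_imp_le by blast
  qed
qed

lemma own_vote_accepted:
  assumes P: "P \<in> set (plist D)" and b: "b \<in> incoming_assets D P"
  shows "\<exists>t p. vote_accepted E b t P p"
proof -
  have "follows_commit D E P" using compliant[OF P] by (simp add: compliant_def)
  then obtain t where t: "validation_time E P < t" "t < t0 D + delta D"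
    "(t, P, Vote P [Sig P P]) \<in> set (ledger E b)"
    using all_validate[OF P] b unfolding follows_commit_def by blast
  then show ?thesis
    using valid_vote_accepted[OF P b t(3,1)] P by (simp add: valid_vote_def signers_def)
qed

lemma accepted_vote_valid:
  assumes "a \<in> deal_assets" "vote_accepted E a t v p"
  shows "valid_vote D t v p"
proof -
  obtain i P e where i: "i < length (ledger E a)" "contract_before E a i = Escrowed e"
    "valid_vote (info e) t v p"
    using assms(2) by (auto simp: vote_accepted_def)
  have "escrow_of (state a i) = Some e"
    using i(2) escrow_of_expire escrow_of.simps(2) unfolding contract_before_def by metis
  then have "info e = D" using escrow_invariant[OF assms(1)] i(1) less_imp_le by blast
  then show ?thesis using i(3) by simp
qed

text \<open>
  If \<open>W\<close> has signed the path of the accepted vote, then it has forwarded the vote before, from an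
  asset where it was accepted without the signature of \<open>W\<close>.
\<close>

lemma unsigned_vote_accepted:
  assumes W: "W \<in> set (plist D)" and a: "a \<in> outgoing_assets D W"
    and acc: "vote_accepted E a t v p" and v: "v \<noteq> W"
  obtains a' t' p' where "a' \<in> outgoing_assets D W" "vote_accepted E a' t' v p'" "W \<notin> signers p'"
proof (cases "W \<in> signers p")
  case True
  have "valid_vote D t v p" using accepted_vote_valid[OF asset_of_party acc] a by blast
  then have "Sig W v \<in> set p"
    using True unfolding valid_vote_def signers_def by (metis imageE signature.collapse)
  moreover obtain R where "(t, R, Vote v p) \<in> set (ledger E a)"
    using acc unfolding vote_accepted_def by (metis nth_mem)
  ultimately obtain a' t' p' where "(t', W, Vote v p') \<in> set (ledger E a')"
    using exec W compliant unfolding timelock_execution_def unforgeable_def by blast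
  moreover have "follows_commit D E W" using compliant[OF W] by (simp add: compliant_def)
  ultimately show ?thesis using that v unfolding follows_commit_def by blast
next
  case False
  then show ?thesis using that a acc by blast
qed

text \<open>The vote that reaches \<open>b\<close> need not extend \<open>p\<close>:
  \<open>W\<close> may have forwarded another vote of \<open>v\<close>, accepted at another outgoing
  asset. Hence the conclusion leaves time and path open.\<close>

lemma vote_forwarded:
  assumes W: "W \<in> set (plist D)" and a: "a \<in> outgoing_assets D W"
    and acc: "vote_accepted E a t v p" and b: "b \<in> incoming_assets D W"
  shows "\<exists>t p. vote_accepted E b t v p"
proof (cases "v = W")
  case True
  then show ?thesis using own_vote_accepted[OF W b] by simp
next
  case False
  \<comment> \<open>The forwarding duty concerns only paths without the signature of
    \<open>W\<close>.\<close>
  obtain a1 t1 p1 where 1: "a1 \<in> outgoing_assets D W" "vote_accepted E a1 t1 v p1"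
    "W \<notin> signers p1" using unsigned_vote_accepted[OF W a acc False] .
  have "follows_commit D E W" using compliant[OF W] by (simp add: compliant_def)
  then obtain a' t' p' s where f: "a' \<in> outgoing_assets D W" "vote_accepted E a' t' v p'"
    "W \<notin> signers p'" "validation_time E W < s" "s \<le> max t' (validation_time E W) + delta D"
    "(s, W, Vote v (p' @ [Sig W v])) \<in> set (ledger E b)"
    using 1 False all_validate[OF W] b unfolding follows_commit_def by metis
  have valid: "valid_vote D t' v p'" using accepted_vote_valid[OF asset_of_party f(2)] f(1) by blast
  \<comment> \<open>For a vote accepted before \<open>W\<close> validated, the delay counts from the
    validation, which precedes \<open>t0\<close> and so every vote deadline.\<close>
  have "max t' (validation_time E W) < t0 D + real (card (signers p')) * delta D"
    using valid validation_before_t0[OF W] delta_pos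
    by (auto simp: valid_vote_def intro: less_le_trans)
  then have "s < t0 D + real (Suc (card (signers p'))) * delta D"
    using f(5) by (simp add: distrib_right max_def split: if_splits)
  \<comment> \<open>\<open>W\<close> is a new signer, so the deadline moves by exactly
    \<open>delta D\<close>, which pays for the propagation.\<close>
  moreover have "signers (p' @ [Sig W v]) = insert W (signers p')"
    "card (insert W (signers p')) = Suc (card (signers p'))"
    using f(3) by (auto simp: signers_def)
  moreover have "p' \<noteq> []" "signer (hd p') = v" "distinct (map signer p')"
    "signers p' \<subseteq> set (plist D)" "\<forall>s \<in> set p'. attested s = v"
    using valid by (auto simp: valid_vote_def)
  ultimately have "valid_vote D s v (p' @ [Sig W v])"
    using f(3) W by (simp add: valid_vote_def signers_def)
  then show ?thesis using valid_vote_accepted[OF W b f(6,4)] by blast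
qed

lemma vote_reaches_all:
  assumes v: "v \<in> set (plist D)" and W: "W \<in> set (plist D)" and b: "b \<in> incoming_assets D W"
  shows "\<exists>t p. vote_accepted E b t v p"
proof -
  have "W \<rightarrow>\<^sup>*\<^bsub>deal_digraph D\<^esub> v"
    using wf v W by (auto simp: well_formed_def strongly_connected_def deal_digraph_def)
  then have "(W, v) \<in> rtrancl_on (set (plist D)) (arcs_ends (deal_digraph D))"
    by (simp add: reachable_def deal_digraph_def)
  then have "\<forall>b \<in> incoming_assets D W. \<exists>t p. vote_accepted E b t v p"
  proof (induction rule: converse_rtrancl_on_induct)
    case base
    then show ?case using own_vote_accepted v by blast
  next
    \<comment> \<open>The asset of an arc from \<open>W\<close> to \<open>U\<close> is incoming for
      \<open>U\<close>, where the vote is accepted by induction, and outgoing for \<open>W\<close>,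
      which therefore passes the vote on to all its incoming assets.\<close>
    case (step W U)
    then obtain x where x: "x \<in> set (deal D)" "sender x = W" "receiver x = U"
      by (auto simp: arcs_ends_def arc_to_ends_def deal_digraph_def)
    then have "asset x \<in> incoming_assets D U" "asset x \<in> outgoing_assets D W"
      by (auto simp: incoming_assets_def outgoing_assets_def)
    then show ?case using step vote_forwarded deal_parties x by metis
  qed
  then show ?thesis using b by blast
qed

lemma all_transfers_permanent: "set (deal D) \<subseteq> permanent_transfers E"
proof
  fix x assume x: "x \<in> set (deal D)"
  let ?a = "asset x" and ?n = "length (ledger E (asset x))"
  have P: "receiver x \<in> set (plist D)" and inc: "?a \<in> incoming_assets D (receiver x)"
    using x deal_parties by (auto simp: incoming_assets_def)
  obtain e where e: "escrow_of (state ?a ?n) = Some e" "info e = D" "tentative e = route D ?a"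
    using after_validation[OF P UnI1[OF inc], of ?n] by auto
  have "v \<in> voted e" if "v \<in> set (plist D)" for v
    using vote_reaches_all[OF that P inc] voted_if_vote_accepted e(1)
    by (metis option.inject order_refl take_all)
  then have rel: "state ?a ?n = Released e" using released_iff_all_voted[OF e(1)] e(2) by blast
  \<comment> \<open>At the last arrival time the whole ledger has been processed, and expiry does
    not affect a released contract.\<close>
  define t where "t = Max (fst ` set (ledger E ?a))"
  have "filter (\<lambda>m. fst m \<le> t) (ledger E ?a) = ledger E ?a"
    by (auto simp: filter_id_conv t_def)
  then have "contract_at E ?a t = Released e" using rel by (simp add: contract_at_def)
  then show "x \<in> permanent_transfers E"
    using x e(3) unfolding permanent_transfers_def
    by (auto simp: route_def intro!: exI[of _ t] exI[of _ e])
qed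

end

text \<open>The inclusion says more than the payoffs, which record assets only: an asset may pass
  through the same hands several times.\<close>

theorem theorem3:
  fixes D :: "('p, 'a) deal_info" and E :: "('p, 'a) execution"
  assumes "timelock_execution D E"
    and "well_formed D"
    and "\<And>P. P \<in> set (plist D) \<Longrightarrow> compliant D E P"
    and "\<And>P. P \<in> set (plist D) \<Longrightarrow> willing_to_accept D E P"
  shows "set (deal D) \<subseteq> permanent_transfers E \<and>
         (\<forall>P \<in> set (plist D). payoff D E P = ALL_payoff D P)"
proof -
  interpret compliant_execution D E by unfold_locales (fact assms)+
  have "set (deal D) \<inter> permanent_transfers E = set (deal D)"
    using all_transfers_permanent by blast
  then show ?thesis by (auto simp: payoff_def ALL_payoff_def)
qed

end
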